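(* For every Blaschke product $B\in\mathcal{H}_{SC}$, the inner functions $B$ and $zB$ (the function $z\mapsto zB(z)$) belong to the same path-connected component of the space $\mathcal{F}$ of all inner functions on $\mathbb{D}$ under the uniform topology.
   Context: $\mathbb{D}$ is the open unit disk in $\mathbb{C}$ and $\partial\mathbb{D}$ the unit circle. The pseudo-hyperbolic distance is $\rho(z,w)=\left|\frac{z-w}{1-\overline{z}w}\right|$ for $z,w\in\mathbb{D}$. An inner function is a bounded analytic function on $\mathbb{D}$ with unimodular radial limits almost everywhere on $\partial\mathbb{D}$. $\mathcal{F}$ is the set of all inner functions, with the uniform topology, i.e. the topology of the metric $d(f,g)=\|f-g\|_\infty=\sup_{z\in\mathbb{D}}|f(z)-g(z)|$. A Blaschke product is an inner function $B(z)=\lambda z^{m}\prod_{n}\frac{|z_n|}{z_n}\frac{z_n-z}{1-\overline{z_n}z}$ with $m\ge 0$ an integer, $|\lambda|=1$, $z_n\in\mathbb{D}\setminus\{0\}$ and $\sum_n(1-|z_n|)<\infty$. Zeros are listed with multiplicity. Strip cone: let $\theta\in(0,\pi)$, $\xi\in\partial\mathbb{D}$, and let $T_1,T_2$ be nonzero real numbers. For $i=1,2$ let $J_i$ be the arc inside $\mathbb{D}$ of the circle $|z-(1-T_ie^{\mathbf{i}\theta})\xi|=|T_i|$, and let $\xi_i$ be the intersection point of this circle with $\partial\mathbb{D}$ other than $\xi$. $SC(\xi,\theta,T_1,T_2)$ is the region in $\mathbb{D}$ bounded by $J_1$, $J_2$ and the arc of $\partial\mathbb{D}$ from $\xi_1$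 to $\xi_2$ not containing $\xi$ (points of $J_1,J_2$ included). Equivalently, it is the set of $z\in\mathbb{D}$ such that $\mathrm{Re}\left(e^{\mathbf{i}\theta}\frac{\xi}{\xi-z}\right)$ lies between $\frac1{2T_1}$ and $\frac1{2T_2}$ (inclusive). If $T_1=T_2$ it is the arc $J_1=J_2$. In particular, if $T_1$ and $T_2$ are infinity, it is the segment $(-1,1)$. $\mathcal{H}_{SC}$ is the family of all Blaschke products $B$ (with infinitely many zeros) such that: (i) the zeros $\{z_n\}_{n=1}^\infty$ of $B$ lie in some strip cone $SC(\xi,\theta,T_1,T_2)$; (ii) $|\xi-z_n|$ is non-increasing in $n$ and tends to $0$; (iii) there is a positive number $\delta<1$ with $\rho(z_n,z_{n+1})\le\delta$ for all $n\in\mathbb{N}$. *)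

theory Defs
  imports "HOL-Complex_Analysis.Complex_Analysis"
begin

definition pseudo_hyp_dist :: "complex \<Rightarrow> complex \<Rightarrow> real" where
  "pseudo_hyp_dist z w = cmod ((z - w) / (1 - cnj z * w))"

text \<open>
  Functions on the open unit disk are represented by functions that take the value
  \<^term>\<open>undefined\<close> off the disk, so that equality of functions means equality on the disk.
  The boundary is parametrised by \<^term>\<open>cis\<close> on \<open>{0..2*pi}\<close>.
\<close>

definition inner_functions :: "(complex \<Rightarrow> complex) set" where
  "inner_functions =
    {f \<in> extensional (ball 0 1).
       f holomorphic_on ball 0 1 \<and> bounded (f ` ball 0 1) \<and>
       (AE t in lebesgue_on {0..2 * pi}.
          \<exists>L. cmod L = 1 \<and> ((\<lambda>r. f (complex_of_real r * cis t)) \<longlongrightarrow> L) (at_left 1))}"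

text \<open>The distance in \<^term>\<open>funspace\<close> is the supremum over the disk of the pointwise distance.\<close>

definition inner_space :: "(complex \<Rightarrow> complex) metric" where
  "inner_space = submetric (funspace (ball 0 1) euclidean_metric) inner_functions"

text \<open>
  \<open>blaschke_with_zeros z B\<close>: \<open>B\<close> is a Blaschke product with infinitely many zeros and the
  sequence \<open>z\<close> lists all of them with multiplicity, in the given order.  Zeros at the origin are
  part of the list; the exponent \<open>m\<close> of the factor \<open>w ^ m\<close> is the number of their occurrences
  (finite because of summability), and the infinite product runs over the remaining zeros.
\<close>

definition blaschke_with_zeros :: "(nat \<Rightarrow> complex) \<Rightarrow> (complex \<Rightarrow> complex) \<Rightarrow> bool" where
  "blaschke_with_zeros z B \<longleftrightarrow>
     range z \<subseteq> ball 0 1 \<and> summable (\<lambda>n. 1 - cmod (z n)) \<and>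
     (\<exists>c. cmod c = 1 \<and>
        B = (\<lambda>w\<in>ball 0 1. c * w ^ card {n. z n = 0} *
               (\<Prod>n. if z n = 0 then 1
                     else complex_of_real (cmod (z n)) / z n * ((z n - w) / (1 - cnj (z n) * w)))))"

text \<open>
  The circle with centre \<open>(1 - T * exp (\<i> * \<theta>)) * \<xi>\<close> and radius \<open>\<bar>T\<bar>\<close> is mapped by
  \<open>z \<mapsto> exp (\<i> * \<theta>) * \<xi> / (\<xi> - z)\<close> onto the vertical line with real part \<open>1 / (2 * T)\<close>, so the
  strip cone is the preimage in the disk of the closed strip between two such lines.  An
  infinite parameter gives the value \<open>0\<close> and corresponds to a straight chord through \<open>\<xi>\<close>.
\<close>

definition strip_cone :: "complex \<Rightarrow> real \<Rightarrow> ereal \<Rightarrow> ereal \<Rightarrow> complex set" where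
  "strip_cone \<xi> \<theta> T1 T2 =
     {z \<in> ball 0 1. Re (cis \<theta> * (\<xi> / (\<xi> - z)))
        \<in> closed_segment (real_of_ereal (1 / (2 * T1))) (real_of_ereal (1 / (2 * T2)))}"

definition H_SC :: "(complex \<Rightarrow> complex) set" where
  "H_SC =
    {B. \<exists>z \<xi> \<theta> T1 T2.
       blaschke_with_zeros z B \<and>
       \<xi> \<in> sphere 0 1 \<and> \<theta> \<in> {0<..<pi} \<and> T1 \<noteq> 0 \<and> T2 \<noteq> 0 \<and>
       range z \<subseteq> strip_cone \<xi> \<theta> T1 T2 \<and>
       decseq (\<lambda>n. cmod (\<xi> - z n)) \<and> (\<lambda>n. cmod (\<xi> - z n)) \<longlonglongrightarrow> 0 \<and>
       (\<exists>\<delta>. 0 < \<delta> \<and> \<delta> < 1 \<and> (\<forall>n. pseudo_hyp_dist (z n) (z (Suc n)) \<le> \<delta>))}"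

end

theory Submission
  imports Defs
begin

text \<open>
  In the coordinate \<open>v = \<xi> / (\<xi> - w) - 1 / 2\<close> the disk is the right half-plane, \<open>\<xi>\<close> is at infinity
  and the strip cone is an honest strip going to infinity nontangentially.  Prepend the image
  \<open>1 / 2\<close> of the origin to the zeros \<open>a\<^sub>n\<close>, which turns \<open>B\<close> into \<open>z B\<close>, and move every zero along a
  segment to the next one; this removes the new zero again.  The change of one factor is explicit:
  with \<open>r\<^sub>n\<close> of the order of \<open>\<bar>a\<^sub>n\<bar>\<close> and nondecreasing, the motion along the strip contributes at most
  a constant times \<open>\<bar>v\<bar> / (\<bar>v\<bar> + r\<^sub>n) - \<bar>v\<bar> / (\<bar>v\<bar> + r\<^sub>n\<^sub>+\<^sub>1)\<close>, which telescopes, and the motion across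
  the strip at most a constant times \<open>1 / r\<^sub>n\<close>, which is summable by the Blaschke condition.  As all
  factors have modulus at most 1, the path is Lipschitz in the supremum norm.
\<close>

section \<open>Blaschke factors of the right half-plane\<close>

text \<open>The unimodular prefactor normalises the half-plane Blaschke factor to the value 1 at v =
  0, so that factors with distant zeros are close to 1 on bounded sets.\<close>

definition hp_factor :: "complex \<Rightarrow> complex \<Rightarrow> complex" where
  "hp_factor a v = cnj a / a * ((a - v) / (cnj a + v))"

lemma Re_le_norm_cnj_add:
  assumes "Re v \<ge> 0" "Re a > 0"
  shows "Re a \<le> cmod (cnj a + v)"
  using complex_Re_le_cmod[of "cnj a + v"] assms by simp

lemma cnj_add_nonzero:
  assumes "Re v \<ge> 0" "Re a > 0"
  shows "cnj a + v \<noteq> 0"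
  using Re_le_norm_cnj_add[OF assms] assms by auto

lemma norm_cnj_add_square:
  "cmod (cnj a + v) ^ 2 - cmod (a - v) ^ 2 = 4 * Re a * Re v"
  unfolding cmod_power2 by (simp add: power2_eq_square algebra_simps)

lemma norm_hp_quotient_le_1:
  assumes "Re v \<ge> 0" "Re a > 0"
  shows "cmod ((a - v) / (cnj a + v)) \<le> 1"
proof -
  have "cmod (a - v) ^ 2 \<le> cmod (cnj a + v) ^ 2"
    using norm_cnj_add_square[of a v] assms
    by (smt (verit) mult_nonneg_nonneg)
  then have "cmod (a - v) \<le> cmod (cnj a + v)"
    by (rule power2_le_imp_le) simp
  then show ?thesis
    using cnj_add_nonzero[OF assms] by (simp add: norm_divide)
qed

lemma norm_hp_factor:
  assumes "Re a > 0"
  shows "cmod (hp_factor a v) = cmod ((a - v) / (cnj a + v))"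
proof -
  have "a \<noteq> 0" using assms by auto
  then show ?thesis by (simp add: hp_factor_def norm_mult norm_divide)
qed

lemma norm_hp_factor_le_1:
  assumes "Re v \<ge> 0" "Re a > 0"
  shows "cmod (hp_factor a v) \<le> 1"
  using norm_hp_factor norm_hp_quotient_le_1 assms by simp

lemma norm_hp_factor_imaginary_axis:
  assumes "Re v = 0" "Re a > 0"
  shows "cmod (hp_factor a v) = 1"
proof -
  have "cmod (a - v) ^ 2 = cmod (cnj a + v) ^ 2"
    using norm_cnj_add_square[of a v] assms by simp
  then have "cmod (a - v) = cmod (cnj a + v)" by simp
  then show ?thesis
    using norm_hp_factor cnj_add_nonzero[of v a] assms by (simp add: norm_divide)
qed

text \<open>The numerator of the difference collapses to -2 v Re a, while |a| and |cnj a + v| are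
  both at least Re a. This supplies the majorant for the convergence of the products.\<close>

lemma norm_hp_factor_minus_1:
  assumes "Re v \<ge> 0" "Re a > 0"
  shows "cmod (hp_factor a v - 1) \<le> 2 * cmod v / Re a"
proof -
  have a: "a \<noteq> 0" and d: "cnj a + v \<noteq> 0"
    using assms cnj_add_nonzero by auto
  have "hp_factor a v - 1 = (cnj a * (a - v) - a * (cnj a + v)) / (a * (cnj a + v))"
    using a d by (subst diff_divide_distrib) (simp add: hp_factor_def)
  also have "cnj a * (a - v) - a * (cnj a + v) = - (v * (a + cnj a))"
    by (simp add: algebra_simps)
  also have "a + cnj a = of_real (2 * Re a)"
    by (rule complex_add_cnj)
  finally have "cmod (hp_factor a v - 1) = cmod v * (2 * Re a) / (cmod a * cmod (cnj a + v))"
    using assms by (simp add: norm_mult norm_divide)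
  also have "\<dots> \<le> cmod v * (2 * Re a) / (Re a * Re a)"
    using assms a d by (intro divide_left_mono mult_mono complex_Re_le_cmod Re_le_norm_cnj_add) auto
  finally show ?thesis using assms by (simp add: mult.commute)
qed

text \<open>After cross-multiplication the terms in v^2 cancel. Only the change of the real part is
  multiplied by v; the other term, up to sign twice the area of the triangle 0, a, c, is small when
  the motion from a to c is almost radial.\<close>

lemma hp_quotient_diff:
  assumes "Re v \<ge> 0" "Re a > 0" "Re c > 0"
  shows "(a - v) / (cnj a + v) - (c - v) / (cnj c + v) =
    2 * (v * of_real (Re (a - c)) + \<i> * of_real (Im (a * cnj c))) /
      ((cnj a + v) * (cnj c + v))"
proof -
  have "(a - v) * (cnj c + v) - (c - v) * (cnj a + v) =
      2 * (v * of_real (Re (a - c)) + \<i> * of_real (Im (a * cnj c)))"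
    by (simp add: complex_eq_iff algebra_simps)
  then show ?thesis
    using cnj_add_nonzero assms by (simp add: diff_frac_eq)
qed

text \<open>The first summand comes from the quotients, the second from the change of the
  normalising prefactor, which depends on the arguments of the zeros only.\<close>

lemma norm_hp_factor_diff:
  assumes v: "Re v \<ge> 0" and a: "Re a > 0" and c: "Re c > 0"
  shows "cmod (hp_factor a v - hp_factor c v) \<le>
    2 * (cmod v * cmod (a - c) + \<bar>Im (a * cnj c)\<bar>) / (cmod (cnj a + v) * cmod (cnj c + v))
    + 2 * \<bar>Im (a * cnj c)\<bar> / (cmod a * cmod c)"
proof -
  define p q where "p = (a - v) / (cnj a + v)" and "q = (c - v) / (cnj c + v)"
  have nz: "a \<noteq> 0" "c \<noteq> 0" using a c by auto
  have "hp_factor a v - hp_factor c v = cnj a / a * (p - q) + (cnj a / a - cnj c / c) * q"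
    by (simp add: hp_factor_def p_def q_def algebra_simps)
  then have "cmod (hp_factor a v - hp_factor c v) \<le>
      cmod (cnj a / a * (p - q)) + cmod ((cnj a / a - cnj c / c) * q)"
    by (metis norm_triangle_ineq)
  also have "\<dots> \<le> cmod (p - q) + cmod (cnj a / a - cnj c / c)"
    using nz mult_left_le[OF norm_hp_quotient_le_1[OF v c], of "cmod (cnj a / a - cnj c / c)"]
    by (simp add: norm_mult norm_divide q_def)
  also have "cmod (p - q) \<le>
      2 * (cmod v * cmod (a - c) + \<bar>Im (a * cnj c)\<bar>) / (cmod (cnj a + v) * cmod (cnj c + v))"
  proof -
    have "cmod (v * of_real (Re (a - c)) + \<i> * of_real (Im (a * cnj c)))
        \<le> cmod v * \<bar>Re (a - c)\<bar> + \<bar>Im (a * cnj c)\<bar>"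
      by (rule norm_triangle_le) (simp only: norm_mult norm_of_real norm_ii mult_1 order_refl)
    also have "\<dots> \<le> cmod v * cmod (a - c) + \<bar>Im (a * cnj c)\<bar>"
      by (intro add_mono mult_left_mono abs_Re_le_cmod) auto
    finally show ?thesis
      unfolding p_def q_def hp_quotient_diff[OF v a c] norm_divide norm_mult
      by (intro divide_right_mono) auto
  qed
  also have "cmod (cnj a / a - cnj c / c) = 2 * \<bar>Im (a * cnj c)\<bar> / (cmod a * cmod c)"
  proof -
    have "cnj a / a - cnj c / c = (cnj a * c - cnj c * a) / (a * c)"
      using nz by (simp add: diff_frac_eq)
    also have "cnj a * c - cnj c * a = - 2 * \<i> * of_real (Im (a * cnj c))"
      by (simp add: complex_eq_iff algebra_simps)
    finally show ?thesis
      by (simp only: norm_divide norm_mult norm_of_real norm_ii norm_neg_numeral mult_1_right)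
  qed
  finally show ?thesis by simp
qed

section \<open>Infinite products with nontangential zeros\<close>

text \<open>A limit of partial products with \<open>lim\<close> is exactly the function that uniform
  convergence of the partial products provides.\<close>

definition hp_prod :: "(nat \<Rightarrow> complex) \<Rightarrow> complex \<Rightarrow> complex" where
  "hp_prod A v = lim (\<lambda>N. \<Prod>n<N. hp_factor (A n) v)"

text \<open>The scale \<open>R\<close> is kept apart from the moduli of the zeros so that one and
  the same scale can serve all intermediate positions of moving zeros. The last condition expresses
  nontangential approach to infinity.\<close>

locale nontangential =
  fixes A :: "nat \<Rightarrow> complex" and R :: "nat \<Rightarrow> real" and \<kappa> :: real
  assumes \<kappa>_pos: "\<kappa> > 0" and R_pos: "\<And>n. R n > 0"
    and summable_R: "summable (\<lambda>n. 1 / R n)"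
    and Re_ge: "\<And>n. \<kappa> * R n \<le> Re (A n)"
begin

lemma Re_pos: "Re (A n) > 0"
  using Re_ge[of n] \<kappa>_pos R_pos[of n] by (smt (verit) mult_pos_pos)

text \<open>The Weierstrass test works on bounded pieces of the closed half-plane. Including the
  imaginary axis makes the product continuous up to the boundary, from which the radial limits are
  read off.\<close>

lemma uniform_limit_hp_prod:
  "uniform_limit ({v. Re v \<ge> 0} \<inter> cball 0 V) (\<lambda>N v. \<Prod>n<N. hp_factor (A n) v) (hp_prod A) sequentially"
  (is "uniform_limit ?K _ _ _")
proof -
  have "uniformly_convergent_on ?K (\<lambda>N v. \<Prod>n<N. hp_factor (A n) v)"
  proof (rule uniformly_convergent_on_prod')
    show "compact ?K"
      by (intro closed_Int_compact closed_halfspace_Re_ge compact_cball)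
    show "continuous_on ?K (hp_factor (A n))" for n
      unfolding hp_factor_def using Re_pos[of n] cnj_add_nonzero
      by (intro continuous_intros) auto
    have "norm (cmod (hp_factor (A n) v - 1)) \<le> 2 * V / \<kappa> * (1 / R n)" if "v \<in> ?K" for n v
    proof -
      have "cmod (hp_factor (A n) v - 1) \<le> 2 * cmod v / Re (A n)"
        using norm_hp_factor_minus_1 Re_pos that by auto
      also have "\<dots> \<le> 2 * V / (\<kappa> * R n)"
        using that Re_ge[of n] \<kappa>_pos R_pos[of n] by (intro frac_le) (auto intro: order_trans[OF norm_ge_zero])
      finally show ?thesis by simp
    qed
    then show "uniformly_convergent_on ?K (\<lambda>N v. \<Sum>n<N. cmod (hp_factor (A n) v - 1))"
      by (intro uniformly_convergentI[OF Weierstrass_m_test_ev[where M = "\<lambda>n. 2 * V / \<kappa> * (1 / R n)"]]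
          always_eventually allI ballI summable_mult summable_R)
  qed
  then show ?thesis
    unfolding uniformly_convergent_uniform_limit_iff hp_prod_def .
qed

lemma hp_prod_LIMSEQ:
  assumes "Re v \<ge> 0"
  shows "(\<lambda>N. \<Prod>n<N. hp_factor (A n) v) \<longlonglongrightarrow> hp_prod A v"
  using tendsto_uniform_limitI[OF uniform_limit_hp_prod[of "cmod v"]] assms by auto

lemma continuous_on_hp_prod:
  "continuous_on ({v. Re v \<ge> 0} \<inter> cball 0 V) (hp_prod A)"
proof (rule uniform_limit_theorem[OF _ uniform_limit_hp_prod])
  show "\<forall>\<^sub>F N in sequentially.
      continuous_on ({v. Re v \<ge> 0} \<inter> cball 0 V) (\<lambda>v. \<Prod>n<N. hp_factor (A n) v)"
    unfolding hp_factor_def using Re_pos cnj_add_nonzero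
    by (intro always_eventually allI continuous_intros) auto
qed simp

lemma norm_hp_prod_le_1:
  assumes "Re v \<ge> 0"
  shows "cmod (hp_prod A v) \<le> 1"
proof (rule tendsto_upperbound)
  show "(\<lambda>N. cmod (\<Prod>n<N. hp_factor (A n) v)) \<longlonglongrightarrow> cmod (hp_prod A v)"
    by (intro tendsto_norm hp_prod_LIMSEQ assms)
  show "\<forall>\<^sub>F N in sequentially. cmod (\<Prod>n<N. hp_factor (A n) v) \<le> 1"
    using norm_hp_factor_le_1[OF assms Re_pos]
    by (intro always_eventually allI) (simp add: prod_norm[symmetric] prod_le_1)
qed simp

lemma norm_hp_prod_imaginary_axis:
  assumes "Re v = 0"
  shows "cmod (hp_prod A v) = 1"
proof (rule LIMSEQ_unique)
  show "(\<lambda>N. cmod (\<Prod>n<N. hp_factor (A n) v)) \<longlonglongrightarrow> cmod (hp_prod A v)"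
    using assms by (intro tendsto_norm hp_prod_LIMSEQ) simp
  show "(\<lambda>N. cmod (\<Prod>n<N. hp_factor (A n) v)) \<longlonglongrightarrow> 1"
    using norm_hp_factor_imaginary_axis[OF assms Re_pos] by (simp add: prod_norm[symmetric])
qed

lemma holomorphic_on_hp_prod: "hp_prod A holomorphic_on {v. Re v > 0}"
proof (rule holomorphic_uniform_sequence)
  show "open {v. Re v > 0}" by (rule open_halfspace_Re_gt)
  show "(\<lambda>v. \<Prod>n<N. hp_factor (A n) v) holomorphic_on {v. Re v > 0}" for N
    unfolding hp_factor_def using Re_pos cnj_add_nonzero
    by (intro holomorphic_intros) (auto simp: less_imp_le)
  fix x assume "x \<in> {v. Re v > 0}"
  then obtain d where d: "d > 0" "cball x d \<subseteq> {v. Re v > 0}"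
    using open_contains_cball[of "{v. Re v > 0}"] open_halfspace_Re_gt[of 0] by auto
  have "cball x d \<subseteq> {v. Re v \<ge> 0} \<inter> cball 0 (cmod x + d)"
    using d(2) by (auto simp: dist_norm) (smt (verit) norm_triangle_ineq3 dist_norm)+
  then have "uniform_limit (cball x d) (\<lambda>N v. \<Prod>n<N. hp_factor (A n) v) (hp_prod A) sequentially"
    using uniform_limit_on_subset uniform_limit_hp_prod by blast
  then show "\<exists>d>0. cball x d \<subseteq> {v. Re v > 0} \<and>
      uniform_limit (cball x d) (\<lambda>N v. \<Prod>n<N. hp_factor (A n) v) (hp_prod A) sequentially"
    using d by blast
qed

end

section \<open>Moving every zero to the next one\<close>

text \<open>The bound \<open>step\<close> splits a displacement into a telescoping increase of the
  scale and a bounded rest; \<open>area\<close> says that consecutive zeros turn little as seen from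
  0. For zeros in a strip, \<open>R_growth\<close> will come from the bound on pseudo-hyperbolic
  distances.\<close>

locale zero_shift = nontangential +
  fixes K C :: real
  assumes R_mono: "\<And>n. R n \<le> R (Suc n)"
    and R_growth: "\<And>n. R (Suc n) \<le> K * R n"
    and norm_le: "\<And>n. cmod (A n) \<le> 2 * R n"
    and step: "\<And>n. cmod (A (Suc n) - A n) \<le> R (Suc n) - R n + C"
    and area: "\<And>n. \<bar>Im (A (Suc n) * cnj (A n))\<bar> \<le> C * R n"
begin

definition move :: "real \<Rightarrow> nat \<Rightarrow> complex" where
  "move t n = A n + of_real t * (A (Suc n) - A n)"

lemma move_0: "move 0 = A" and move_1: "move 1 = (\<lambda>n. A (Suc n))"
  by (simp_all add: move_def fun_eq_iff)

lemma C_nonneg: "C \<ge> 0"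
  using area[of 0] R_pos[of 0] abs_ge_zero by (metis mult_less_0_iff not_less order_trans)

lemma K_ge_1: "K \<ge> 1"
  using R_mono[of 0] R_growth[of 0] R_pos[of 0]
  by (smt (verit) mult_right_less_imp_less mult_cancel_right1)

text \<open>Half-planes are convex, and by monotonicity of \<open>R\<close> both ends of the n-th
  segment have real part at least \<open>\<kappa> * R n\<close>.\<close>

lemma nontangential_move:
  assumes "t \<in> {0..1}"
  shows "nontangential (move t) R \<kappa>"
proof
  fix n
  have "\<kappa> * R n = (1 - t) * (\<kappa> * R n) + t * (\<kappa> * R n)"
    by (simp add: algebra_simps)
  also have "\<dots> \<le> (1 - t) * (\<kappa> * R n) + t * (\<kappa> * R (Suc n))"
    using assms \<kappa>_pos R_mono by (intro add_left_mono mult_left_mono) auto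
  also have "\<dots> \<le> (1 - t) * Re (A n) + t * Re (A (Suc n))"
    using assms by (intro add_mono mult_left_mono Re_ge) auto
  also have "\<dots> = Re (move t n)"
    by (simp add: move_def algebra_simps)
  finally show "\<kappa> * R n \<le> Re (move t n)" .
qed (fact \<kappa>_pos R_pos summable_R)+

lemma norm_move_le:
  assumes "t \<in> {0..1}"
  shows "cmod (move t n) \<le> 2 * K * R n"
proof -
  have "move t n = of_real (1 - t) * A n + of_real t * A (Suc n)"
    by (simp add: move_def algebra_simps)
  then have "cmod (move t n) \<le> (1 - t) * cmod (A n) + t * cmod (A (Suc n))"
    using assms norm_triangle_ineq[of "of_real (1 - t) * A n" "of_real t * A (Suc n)"]
    by (simp add: norm_mult del: of_real_diff)
  also have "\<dots> \<le> (1 - t) * (2 * K * R n) + t * (2 * K * R n)"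
    using assms norm_le[of n] norm_le[of "Suc n"] R_growth[of n] R_mono[of n]
    by (intro add_mono mult_left_mono) auto
  finally show ?thesis by (simp add: algebra_simps)
qed

definition M :: real where
  "M = 1 + (2 * K + 1) / \<kappa>"

text \<open>The denominator dominates the real part of the moving zero, hence \<open>R n\<close>.
  Since the modulus of that zero is also at most a multiple of \<open>R n\<close>, the triangle
  inequality then controls |v| as well.\<close>

lemma norm_denominator_ge:
  assumes t: "t \<in> {0..1}" and v: "Re v \<ge> 0"
  shows "cmod v + R n \<le> M * cmod (cnj (move t n) + v)"
proof -
  interpret m: nontangential "move t" R \<kappa> by (rule nontangential_move[OF t])
  define D where "D = cmod (cnj (move t n) + v)"
  have "\<kappa> * R n \<le> D"
    using m.Re_ge Re_le_norm_cnj_add[OF v m.Re_pos] order_trans unfolding D_def by blast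
  then have R: "R n \<le> D / \<kappa>"
    using \<kappa>_pos by (simp add: field_simps)
  have "cmod v \<le> D + cmod (cnj (move t n))"
    unfolding D_def by (metis add_diff_cancel_left' norm_triangle_ineq4)
  also have "\<dots> \<le> D + 2 * K * R n"
    using norm_move_le[OF t] by simp
  finally have "cmod v + R n \<le> D + (2 * K + 1) * R n"
    by (simp add: algebra_simps)
  also have "\<dots> \<le> D + (2 * K + 1) * (D / \<kappa>)"
    using R K_ge_1 by (intro add_left_mono mult_left_mono) auto
  also have "\<dots> = M * D"
    by (simp add: M_def add_divide_distrib algebra_simps)
  finally show ?thesis
    unfolding D_def .
qed

text \<open>The total coefficient of \<open>1 / R n\<close> in the next estimate: the first summand
  comes from the constant rests in the quotient term, the second from the normalising
  prefactors.\<close>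

definition E :: real where
  "E = 4 * M ^ 2 * C + 2 * C / \<kappa> ^ 2"

text \<open>The first summand telescopes; this is where the monotonicity of \<^term>\<open>R\<close> enters.\<close>

lemma norm_factor_move_diff:
  assumes t: "t \<in> {0..1}" and s: "s \<in> {0..1}" and v: "Re v \<ge> 0"
  shows "cmod (hp_factor (move t n) v - hp_factor (move s n) v) \<le>
    \<bar>t - s\<bar> * (2 * M ^ 2 * K * (cmod v / (cmod v + R n) - cmod v / (cmod v + R (Suc n))) + E * (1 / R n))"
proof -
  interpret t: nontangential "move t" R \<kappa> by (rule nontangential_move[OF t])
  interpret s: nontangential "move s" R \<kappa> by (rule nontangential_move[OF s])
  define x r r' h where "x = cmod v" and "r = R n" and "r' = R (Suc n)" and "h = \<bar>t - s\<bar>"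
  have r: "0 < r" "r \<le> r'" "r' \<le> K * r" and x: "x \<ge> 0" and h: "h \<ge> 0"
    using R_pos R_mono R_growth by (auto simp: r_def r'_def x_def h_def)
  have M: "M > 0" unfolding M_def using K_ge_1 \<kappa>_pos by (simp add: add_pos_nonneg)
  have dist: "cmod (move t n - move s n) \<le> h * (r' - r + C)"
  proof -
    have "move t n - move s n = of_real (t - s) * (A (Suc n) - A n)"
      by (simp add: move_def algebra_simps)
    then have "cmod (move t n - move s n) = h * cmod (A (Suc n) - A n)"
      by (simp add: norm_mult h_def del: of_real_diff)
    then show ?thesis
      using step[of n] by (simp add: h_def r_def r'_def mult_left_mono)
  qed
  have ar: "\<bar>Im (move t n * cnj (move s n))\<bar> \<le> h * (C * r)"
  proof -
    \<comment> \<open>The expression Im (x * cnj y) is real bilinear and alternating, so two points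
      of one segment give a multiple of its value at the endpoints.\<close>
    have "Im (move t n * cnj (move s n)) = (t - s) * Im (A (Suc n) * cnj (A n))"
      by (simp add: move_def algebra_simps)
    then show ?thesis
      using area[of n] by (simp add: abs_mult h_def r_def mult_left_mono)
  qed
  have den: "(x + r) ^ 2 / M ^ 2 \<le> cmod (cnj (move t n) + v) * cmod (cnj (move s n) + v)"
  proof -
    have "(x + r) * (x + r) \<le> (M * cmod (cnj (move t n) + v)) * (M * cmod (cnj (move s n) + v))"
      unfolding x_def r_def using norm_denominator_ge[OF t v] norm_denominator_ge[OF s v] R_pos[of n] M
      by (intro mult_mono) auto
    then show ?thesis
      using M by (simp add: field_simps power2_eq_square)
  qed
  have den': "(\<kappa> * r) ^ 2 \<le> cmod (move t n) * cmod (move s n)"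
    unfolding power2_eq_square r_def using R_pos[of n] \<kappa>_pos
    by (intro mult_mono order_trans[OF t.Re_ge complex_Re_le_cmod]
        order_trans[OF s.Re_ge complex_Re_le_cmod]) auto
  have "cmod (hp_factor (move t n) v - hp_factor (move s n) v) \<le>
      2 * (x * cmod (move t n - move s n) + \<bar>Im (move t n * cnj (move s n))\<bar>) /
        (cmod (cnj (move t n) + v) * cmod (cnj (move s n) + v))
      + 2 * \<bar>Im (move t n * cnj (move s n))\<bar> / (cmod (move t n) * cmod (move s n))"
    unfolding x_def by (rule norm_hp_factor_diff[OF v t.Re_pos s.Re_pos])
  also have "\<dots> \<le> 2 * (x * (h * (r' - r + C)) + h * (C * r)) / ((x + r) ^ 2 / M ^ 2)
      + 2 * (h * (C * r)) / (\<kappa> * r) ^ 2"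
    using dist ar den den' x h r M C_nonneg \<kappa>_pos
    by (intro add_mono frac_le mult_left_mono) auto
  also have "\<dots> = h * (2 * M\<^sup>2 * (x * (r' - r) / (x + r)\<^sup>2 + C * (x / (x + r)\<^sup>2) + C * (r / (x + r)\<^sup>2))
      + 2 * C / \<kappa>\<^sup>2 * (1 / r))"
  proof -
    have 1: "2 * (x * (h * (r' - r + C)) + h * (C * r)) / ((x + r) ^ 2 / M ^ 2) =
        h * (2 * M\<^sup>2 * (x * (r' - r) / (x + r)\<^sup>2 + C * (x / (x + r)\<^sup>2) + C * (r / (x + r)\<^sup>2)))"
      by (simp add: distrib_left distrib_right diff_divide_distrib add_divide_distrib algebra_simps)
    have 2: "2 * (h * (C * r)) / (\<kappa> * r) ^ 2 = h * (2 * C / \<kappa>\<^sup>2 * (1 / r))"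
      using r by (simp add: power2_eq_square mult_ac)
    show ?thesis
      unfolding 1 2 by (rule distrib_left[symmetric])
  qed
  also have "\<dots> \<le> h * (2 * M\<^sup>2 * (K * (x / (x + r) - x / (x + r')) + C * (1 / r) + C * (1 / r))
      + 2 * C / \<kappa>\<^sup>2 * (1 / r))"
  proof -
    \<comment> \<open>At the price of \<open>K\<close>, one of the two factors x + r in the
      denominator is exchanged for x + r'. The fraction then becomes an exact difference of
      consecutive terms.\<close>
    have "x + r' \<le> K * (x + r)"
      using r x K_ge_1 mult_right_mono[of 1 K x] by (simp add: algebra_simps)
    then have "1 / (x + r) \<le> K / (x + r')"
      using r x by (simp add: field_simps)
    then have "x * (r' - r) / (x + r) * (1 / (x + r)) \<le> x * (r' - r) / (x + r) * (K / (x + r'))"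
      using r x by (intro mult_left_mono) auto
    also have "\<dots> = K * (x / (x + r) - x / (x + r'))"
      using r x by (simp add: field_simps)
    finally have 1: "x * (r' - r) / (x + r)\<^sup>2 \<le> K * (x / (x + r) - x / (x + r'))"
      by (simp add: power2_eq_square)
    \<comment> \<open>Needed for y = x and for y = r.\<close>
    have 2: "y / (x + r)\<^sup>2 \<le> 1 / r" if "0 \<le> y" "y \<le> x + r" for y
    proof -
      have "y / (x + r)\<^sup>2 \<le> (x + r) / (x + r)\<^sup>2"
        using that by (intro divide_right_mono) auto
      also have "\<dots> = 1 / (x + r)"
        using r x by (simp add: power2_eq_square)
      also have "\<dots> \<le> 1 / r"
        using r x by (intro divide_left_mono) auto
      finally show ?thesis .
    qed
    show ?thesis
      using h C_nonneg r x by (intro mult_left_mono add_mono 1 2) auto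
  qed
  also have "\<dots> = h * (2 * M\<^sup>2 * K * (x / (x + r) - x / (x + r')) + E * (1 / r))"
    by (simp add: E_def algebra_simps)
  finally show ?thesis
    unfolding x_def r_def r'_def h_def .
qed

definition L :: real where
  "L = 2 * M ^ 2 * K + E * (\<Sum>n. 1 / R n)"

text \<open>All factors have modulus at most 1, so the difference of two products is at most the sum
  of the differences of their factors. The resulting bound depends neither on v nor on the number of
  factors.\<close>

lemma hp_prod_move_Lipschitz:
  assumes t: "t \<in> {0..1}" and s: "s \<in> {0..1}" and v: "Re v \<ge> 0"
  shows "cmod (hp_prod (move t) v - hp_prod (move s) v) \<le> L * \<bar>t - s\<bar>"
proof (rule tendsto_upperbound)
  interpret t: nontangential "move t" R \<kappa> by (rule nontangential_move[OF t])
  interpret s: nontangential "move s" R \<kappa> by (rule nontangential_move[OF s])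
  show "(\<lambda>N. cmod ((\<Prod>n<N. hp_factor (move t n) v) - (\<Prod>n<N. hp_factor (move s n) v)))
      \<longlonglongrightarrow> cmod (hp_prod (move t) v - hp_prod (move s) v)"
    by (intro tendsto_norm tendsto_diff t.hp_prod_LIMSEQ s.hp_prod_LIMSEQ v)
  have "cmod ((\<Prod>n<N. hp_factor (move t n) v) - (\<Prod>n<N. hp_factor (move s n) v)) \<le> L * \<bar>t - s\<bar>" for N
  proof -
    define f where "f n = cmod v / (cmod v + R n)" for n
    have f: "0 \<le> f n" "f n \<le> 1" for n
      using R_pos[of n] by (simp_all add: f_def divide_le_eq add_nonneg_pos)
    have E: "E \<ge> 0" unfolding E_def using C_nonneg by simp
    have "cmod ((\<Prod>n<N. hp_factor (move t n) v) - (\<Prod>n<N. hp_factor (move s n) v))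
        \<le> (\<Sum>n<N. cmod (hp_factor (move t n) v - hp_factor (move s n) v))"
      by (intro norm_prod_diff norm_hp_factor_le_1 v t.Re_pos s.Re_pos)
    also have "\<dots> \<le> (\<Sum>n<N. \<bar>t - s\<bar> * (2 * M ^ 2 * K * (f n - f (Suc n)) + E * (1 / R n)))"
      unfolding f_def by (intro sum_mono norm_factor_move_diff t s v)
    also have "\<dots> = \<bar>t - s\<bar> * (2 * M ^ 2 * K * (\<Sum>n<N. f n - f (Suc n)) + E * (\<Sum>n<N. 1 / R n))"
      by (simp only: sum_distrib_left sum.distrib distrib_left)
    also have "(\<Sum>n<N. f n - f (Suc n)) = f 0 - f N"
      by (rule sum_lessThan_telescope')
    \<comment> \<open>As \<open>f\<close> takes values between 0 and 1, the telescoped sum is at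
      most 1 for every v; this is the uniformity in v.\<close>
    also have "\<bar>t - s\<bar> * (2 * M ^ 2 * K * (f 0 - f N) + E * (\<Sum>n<N. 1 / R n)) \<le>
       \<bar>t - s\<bar> * (2 * M ^ 2 * K * 1 + E * (\<Sum>n. 1 / R n))"
      using f[of 0] f[of N] K_ge_1 E R_pos
      by (intro mult_left_mono add_mono sum_le_suminf summable_R) (auto simp: less_imp_le)
    finally show ?thesis
      by (simp add: L_def mult.commute)
  qed
  then show "\<forall>\<^sub>F N in sequentially.
      cmod ((\<Prod>n<N. hp_factor (move t n) v) - (\<Prod>n<N. hp_factor (move s n) v)) \<le> L * \<bar>t - s\<bar>"
    by (intro always_eventually allI)
qed simp

end

section \<open>Passing to the disk\<close>

definition cayley :: "complex \<Rightarrow> complex \<Rightarrow> complex" where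
  "cayley \<xi> w = \<xi> / (\<xi> - w) - 1 / 2"

lemma Re_cayley:
  assumes "cmod \<xi> = 1" "w \<noteq> \<xi>"
  shows "Re (cayley \<xi> w) = (1 - (cmod w)\<^sup>2) / (2 * (cmod (\<xi> - w))\<^sup>2)"
proof -
  have pos: "(cmod (\<xi> - w))\<^sup>2 > 0" using assms by simp
  have "1 = (Re \<xi>)\<^sup>2 + (Im \<xi>)\<^sup>2"
    using assms(1) cmod_power2[of \<xi>] by simp
  then have "2 * (Re \<xi> * Re (\<xi> - w) + Im \<xi> * Im (\<xi> - w)) - (cmod (\<xi> - w))\<^sup>2 = 1 - (cmod w)\<^sup>2"
    unfolding cmod_power2 by (simp add: power2_eq_square algebra_simps)
  moreover have "Re (cayley \<xi> w) = (Re \<xi> * Re (\<xi> - w) + Im \<xi> * Im (\<xi> - w)) / (cmod (\<xi> - w))\<^sup>2 - 1 / 2"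
    unfolding cayley_def cmod_power2 by (simp add: Re_divide)
  ultimately show ?thesis
    using pos by (simp add: field_simps)
qed

lemma Re_cayley_nonneg:
  assumes "cmod \<xi> = 1" "w \<noteq> \<xi>" "cmod w \<le> 1"
  shows "Re (cayley \<xi> w) \<ge> 0"
  using assms by (simp add: Re_cayley power_le_one)

lemma Re_cayley_pos:
  assumes "cmod \<xi> = 1" "cmod w < 1"
  shows "Re (cayley \<xi> w) > 0"
proof -
  have "w \<noteq> \<xi>" using assms by auto
  moreover have "(cmod w)\<^sup>2 < 1" using assms(2) by (simp add: power_less_one_iff)
  ultimately show ?thesis using assms by (simp add: Re_cayley)
qed

lemma Re_cayley_circle:
  assumes "cmod \<xi> = 1" "w \<noteq> \<xi>" "cmod w = 1"
  shows "Re (cayley \<xi> w) = 0"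
  using assms by (simp add: Re_cayley)

text \<open>As functions of w, both fractions are Moebius maps with the same zero and the same pole,
  so their ratio is a constant; \<open>\<mu>\<close> is therefore chosen before w.\<close>

lemma disk_factor_eq_hp_quotient:
  assumes \<xi>: "cmod \<xi> = 1" and z: "cmod z < 1"
  obtains \<mu> where "cmod \<mu> = 1"
    "\<And>w. cmod w < 1 \<Longrightarrow> (z - w) / (1 - cnj z * w) =
       \<mu> * ((cayley \<xi> z - cayley \<xi> w) / (cnj (cayley \<xi> z) + cayley \<xi> w))"
proof
  define \<mu> where "\<mu> = (\<xi> - z) / (1 - \<xi> * cnj z)"
  have \<xi>1: "\<xi> * cnj \<xi> = 1" using \<xi> by (simp add: complex_norm_square[symmetric])
  have nz: "\<xi> - z \<noteq> 0" using assms by auto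
  have e: "1 - \<xi> * cnj z = \<xi> * cnj (\<xi> - z)"
    using \<xi>1 by (simp add: algebra_simps)
  have nz': "1 - \<xi> * cnj z \<noteq> 0"
    unfolding e using nz \<xi> by (metis complex_cnj_zero_iff mult_eq_0_iff norm_zero zero_neq_one)
  show "cmod \<mu> = 1"
    unfolding \<mu>_def e using nz \<xi> by (simp add: norm_divide norm_mult del: complex_cnj_diff)
  fix w assume w: "cmod w < 1"
  have nw: "\<xi> - w \<noteq> 0" using \<xi> w by auto
  have \<xi>0: "\<xi> \<noteq> 0" using \<xi> by auto
  have "cnj z * w \<noteq> 1"
  proof
    assume "cnj z * w = 1"
    then have "cmod z * cmod w = 1" by (metis norm_mult complex_mod_cnj norm_one)
    then show False
      using z w mult_strict_mono'[of "cmod z" 1 "cmod w" 1] by simp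
  qed
  then have nzw: "1 - cnj z * w \<noteq> 0" by simp
  have "cayley \<xi> z - cayley \<xi> w = \<xi> / (\<xi> - z) - \<xi> / (\<xi> - w)"
    by (simp add: cayley_def)
  also have "\<dots> = \<xi> * (z - w) / ((\<xi> - z) * (\<xi> - w))"
    using nz nw by (simp add: diff_frac_eq algebra_simps)
  finally have n: "cayley \<xi> z - cayley \<xi> w = \<xi> * (z - w) / ((\<xi> - z) * (\<xi> - w))" .
  have "cnj (\<xi> / (\<xi> - z)) = 1 / (1 - \<xi> * cnj z)"
  proof -
    have "cnj (\<xi> / (\<xi> - z)) = cnj \<xi> / cnj (\<xi> - z)" by simp
    also have "\<dots> = (\<xi> * cnj \<xi>) / (\<xi> * cnj (\<xi> - z))" using \<xi>0 by simp
    finally show ?thesis unfolding e \<xi>1 .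
  qed
  moreover have "\<xi> / (\<xi> - w) - 1 = w / (\<xi> - w)"
    using nw by (simp add: field_simps)
  moreover have "cnj (cayley \<xi> z) + cayley \<xi> w = cnj (\<xi> / (\<xi> - z)) + (\<xi> / (\<xi> - w) - 1)"
    by (simp add: cayley_def)
  ultimately have "cnj (cayley \<xi> z) + cayley \<xi> w = 1 / (1 - \<xi> * cnj z) + w / (\<xi> - w)"
    by (simp only:)
  also have "\<dots> = \<xi> * (1 - cnj z * w) / ((1 - \<xi> * cnj z) * (\<xi> - w))"
    using nz' nw by (simp add: add_frac_eq algebra_simps)
  finally have d: "cnj (cayley \<xi> z) + cayley \<xi> w = \<xi> * (1 - cnj z * w) / ((1 - \<xi> * cnj z) * (\<xi> - w))" .
  show "(z - w) / (1 - cnj z * w) =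
      \<mu> * ((cayley \<xi> z - cayley \<xi> w) / (cnj (cayley \<xi> z) + cayley \<xi> w))"
    unfolding n d \<mu>_def using nz nz' nw \<xi>0 nzw by (simp add: divide_simps)
qed

text \<open>The identity function is itself a half-plane factor, up to a unimodular constant.
  Multiplying \<open>B\<close> by it amounts to adding one zero.\<close>

lemma hp_factor_origin:
  assumes "cmod \<xi> = 1" "cmod w < 1"
  shows "w = - \<xi> * hp_factor (1 / 2) (cayley \<xi> w)"
proof -
  have "\<xi> - w \<noteq> 0" "\<xi> \<noteq> 0" using assms by auto
  then show ?thesis
    by (simp add: hp_factor_def cayley_def field_simps)
qed

section \<open>Radial limits and membership in the set of inner functions\<close>

lemma AE_cis_neq: "AE t in lebesgue_on {0..2 * pi}. cis t \<noteq> \<xi>"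
proof -
  \<comment> \<open>The endpoint 2 * pi is listed separately because \<open>Arg2pi\<close> takes
    values below 2 * pi.\<close>
  have "{t \<in> {0..2 * pi}. cis t = \<xi>} \<subseteq> {Arg2pi \<xi>, 2 * pi}"
  proof
    fix t assume t: "t \<in> {t \<in> {0..2 * pi}. cis t = \<xi>}"
    have "t = Arg2pi \<xi>" if "t \<noteq> 2 * pi"
      using t that by (intro Arg2pi_unique[where r = 1, symmetric]) (auto simp: cis_conv_exp)
    then show "t \<in> {Arg2pi \<xi>, 2 * pi}" by blast
  qed
  then have "finite {t \<in> {0..2 * pi}. cis t = \<xi>}"
    by (rule finite_subset) simp
  then have "{t \<in> {0..2 * pi}. cis t = \<xi>} \<in> null_sets lebesgue"
    using negligible_finite negligible_iff_null_sets by blast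
  then have "AE t in lebesgue. t \<in> {0..2 * pi} \<longrightarrow> cis t \<noteq> \<xi>"
    by (rule AE_I') auto
  then show ?thesis
    by (subst AE_restrict_space_iff) auto
qed

text \<open>Every boundary point other than \<xi> goes to a finite point of the imaginary axis,
  where the product is unimodular and continuous from the closed half-plane. So the radial limit can
  fail to exist only at \<xi>.\<close>

lemma (in nontangential) inner_function:
  assumes \<xi>: "cmod \<xi> = 1" and c: "cmod c = 1"
  shows "(\<lambda>w\<in>ball 0 1. c * hp_prod A (cayley \<xi> w)) \<in> inner_functions"
proof -
  let ?f = "\<lambda>w\<in>ball 0 1. c * hp_prod A (cayley \<xi> w)"
  have "cayley \<xi> holomorphic_on ball 0 1"
    unfolding cayley_def using \<xi> by (intro holomorphic_intros) auto
  then have "(hp_prod A \<circ> cayley \<xi>) holomorphic_on ball 0 1"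
    using Re_cayley_pos[OF \<xi>] by (intro holomorphic_on_compose_gen[OF _ holomorphic_on_hp_prod]) auto
  then have "(\<lambda>w. c * (hp_prod A \<circ> cayley \<xi>) w) holomorphic_on ball 0 1"
    by (intro holomorphic_intros)
  then have hol: "?f holomorphic_on ball 0 1"
    by (rule holomorphic_transform) simp
  have bd: "bounded (?f ` ball 0 1)"
    using Re_cayley_pos[OF \<xi>] c
    by (intro boundedI[of _ 1]) (auto simp: norm_mult less_imp_le intro!: norm_hp_prod_le_1)
  have radial: "\<exists>L. cmod L = 1 \<and> ((\<lambda>r. ?f (complex_of_real r * cis t)) \<longlongrightarrow> L) (at_left 1)"
    if t: "cis t \<noteq> \<xi>" for t
  proof (intro exI conjI)
    define l where "l = cayley \<xi> (cis t)"
    \<comment> \<open>The image of the radius eventually stays in the ball of radius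
      \<open>V\<close>, inside which continuity up to the axis is available.\<close>
    define V where "V = cmod l + 1"
    have Re_l: "Re l = 0"
      unfolding l_def using \<xi> t by (intro Re_cayley_circle) auto
    show "cmod (c * hp_prod A l) = 1"
      using c norm_hp_prod_imaginary_axis[OF Re_l] by (simp add: norm_mult)
    have lim: "((\<lambda>r. cayley \<xi> (complex_of_real r * cis t)) \<longlongrightarrow> l) (at_left 1)"
    proof -
      have "((\<lambda>r. complex_of_real r * cis t) \<longlongrightarrow> complex_of_real 1 * cis t) (at_left 1)"
        by (intro tendsto_intros)
      then show ?thesis
        unfolding l_def cayley_def using t by (intro tendsto_intros) auto
    qed
    have ev: "\<forall>\<^sub>F r in at_left 1. r \<in> {0<..<1::real}"
      by (rule eventually_at_left_real) simp
    have disk: "cmod (complex_of_real r * cis t) < 1" if "r \<in> {0<..<1}" for r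
      using that by (simp add: norm_mult)
    have "\<forall>\<^sub>F r in at_left 1. cmod (cayley \<xi> (complex_of_real r * cis t)) < V"
      using tendsto_norm[OF lim] by (rule order_tendstoD) (simp add: V_def)
    with ev have "\<forall>\<^sub>F r in at_left 1.
        cayley \<xi> (complex_of_real r * cis t) \<in> {v. Re v \<ge> 0} \<inter> cball 0 V"
      by eventually_elim (use Re_cayley_pos[OF \<xi> disk] in \<open>auto intro: less_imp_le\<close>)
    then have "((\<lambda>r. hp_prod A (cayley \<xi> (complex_of_real r * cis t))) \<longlongrightarrow> hp_prod A l) (at_left 1)"
      by (intro continuous_on_tendsto_compose[OF continuous_on_hp_prod[of V] lim])
        (auto simp: Re_l V_def)
    then have "((\<lambda>r. c * hp_prod A (cayley \<xi> (complex_of_real r * cis t))) \<longlongrightarrow> c * hp_prod A l) (at_left 1)"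
      by (intro tendsto_intros)
    moreover have "\<forall>\<^sub>F r in at_left 1.
        c * hp_prod A (cayley \<xi> (complex_of_real r * cis t)) = ?f (complex_of_real r * cis t)"
      using ev by eventually_elim (use disk in auto)
    ultimately show "((\<lambda>r. ?f (complex_of_real r * cis t)) \<longlongrightarrow> c * hp_prod A l) (at_left 1)"
      by (rule Lim_transform_eventually)
  qed
  have "AE t in lebesgue_on {0..2 * pi}.
      \<exists>L. cmod L = 1 \<and> ((\<lambda>r. ?f (complex_of_real r * cis t)) \<longlongrightarrow> L) (at_left 1)"
    using AE_cis_neq[of \<xi>] by (rule AE_mp) (intro AE_I2 impI radial)
  with hol bd show ?thesis
    unfolding inner_functions_def by simp
qed

section \<open>The uniform metric and the path of inner functions\<close>

lemma inner_functions_subset_fspace: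
  "inner_functions \<subseteq> mspace (funspace (ball 0 1) euclidean_metric)"
  by (auto simp: inner_functions_def Met_TC.fspace_def Met_TC.mbounded_def)

lemma mspace_inner_space: "mspace inner_space = inner_functions"
  using inner_functions_subset_fspace by (auto simp: inner_space_def)

lemma mdist_inner_space_le:
  assumes "f \<in> inner_functions" "g \<in> inner_functions"
    and "\<And>w. cmod w < 1 \<Longrightarrow> cmod (f w - g w) \<le> b"
  shows "mdist inner_space f g \<le> b"
proof -
  have "f \<in> Met_TC.fspace (ball 0 1)" "g \<in> Met_TC.fspace (ball 0 1)"
    using assms inner_functions_subset_fspace by auto
  then have "mdist inner_space f g = (SUP w\<in>ball 0 1. dist (f w) (g w))"
    by (simp add: inner_space_def Met_TC.fdist_def)
  also have "\<dots> \<le> b"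
    using assms(3) by (intro cSUP_least) (auto simp: dist_norm)
  finally show ?thesis .
qed

lemma norm_cis_diff_le: "cmod (cis x - cis y) \<le> \<bar>x - y\<bar>"
proof -
  have "cis x - cis y = cis y * (exp (\<i> * of_real (x - y)) - 1)"
    by (simp add: cis_conv_exp[symmetric] cis_mult algebra_simps del: of_real_diff)
  then have "cmod (cis x - cis y) = 2 * \<bar>sin ((x - y) / 2)\<bar>"
    by (simp only: norm_mult norm_cis dist_exp_i_1 mult_1)
  also have "\<dots> \<le> 2 * \<bar>(x - y) / 2\<bar>"
    by (intro mult_left_mono abs_sin_x_le_abs_x) simp
  finally show ?thesis by simp
qed

text \<open>While the zeros move, the argument of the unimodular constant is interpolated linearly.
  At time 1 each zero has reached its successor, so the first one has disappeared from the
  list.\<close>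

lemma (in zero_shift) path_component_of_shift:
  assumes \<xi>: "cmod \<xi> = 1" and b: "cmod b = 1" and c: "cmod c = 1"
  shows "path_component_of (mtopology_of inner_space)
    (\<lambda>w\<in>ball 0 1. b * hp_prod A (cayley \<xi> w))
    (\<lambda>w\<in>ball 0 1. c * hp_prod (\<lambda>n. A (Suc n)) (cayley \<xi> w))"
proof -
  define x y where "x = Arg b" and "y = Arg c"
  have xy: "b = cis x" "c = cis y"
    using b c cis_Arg[of b] cis_Arg[of c] by (force simp: x_def y_def sgn_div_norm)+
  define ph where "ph t = cis (x + t * (y - x))" for t
  define \<gamma> where "\<gamma> t = (\<lambda>w\<in>ball 0 1. ph t * hp_prod (move t) (cayley \<xi> w))" for t
  have inner: "\<gamma> t \<in> inner_functions" if "t \<in> {0..1}" for t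
  proof -
    interpret m: nontangential "move t" R \<kappa> by (rule nontangential_move[OF that])
    show ?thesis unfolding \<gamma>_def ph_def by (intro m.inner_function \<xi>) simp
  qed
  have "mdist inner_space (\<gamma> t) (\<gamma> s) \<le> (L + \<bar>y - x\<bar>) * \<bar>t - s\<bar>"
    if t: "t \<in> {0..1}" and s: "s \<in> {0..1}" for t s
  proof (rule mdist_inner_space_le)
    fix w :: complex assume w: "cmod w < 1"
    interpret m: nontangential "move s" R \<kappa> by (rule nontangential_move[OF s])
    define v where "v = cayley \<xi> w"
    have v: "Re v \<ge> 0" unfolding v_def using Re_cayley_pos[OF \<xi> w] by simp
    \<comment> \<open>The product rule separates the motion of the zeros from that of the constant;
      the remaining product has modulus at most 1.\<close>
    have "\<gamma> t w - \<gamma> s w = ph t * (hp_prod (move t) v - hp_prod (move s) v) + (ph t - ph s) * hp_prod (move s) v"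
      using w by (simp add: \<gamma>_def v_def algebra_simps)
    also have "cmod \<dots> \<le> cmod (hp_prod (move t) v - hp_prod (move s) v) + cmod (ph t - ph s)"
      using mult_left_le[OF m.norm_hp_prod_le_1[OF v], of "cmod (ph t - ph s)"]
      by (intro norm_triangle_mono) (auto simp: norm_mult ph_def)
    also have "\<dots> \<le> L * \<bar>t - s\<bar> + \<bar>(x + t * (y - x)) - (x + s * (y - x))\<bar>"
      unfolding ph_def by (intro add_mono hp_prod_move_Lipschitz norm_cis_diff_le t s v)
    also have "(x + t * (y - x)) - (x + s * (y - x)) = (y - x) * (t - s)"
      by (simp add: algebra_simps)
    finally show "cmod (\<gamma> t w - \<gamma> s w) \<le> (L + \<bar>y - x\<bar>) * \<bar>t - s\<bar>"
      by (simp only: abs_mult distrib_right)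
  qed (use inner t s in auto)
  then have "Lipschitz_continuous_map (submetric euclidean_metric {0..1}) inner_space \<gamma>"
    using inner
    by (auto simp: Lipschitz_continuous_map_def mspace_inner_space dist_real_def
        intro!: exI[of _ "L + \<bar>y - x\<bar>"])
  then have "continuous_map (mtopology_of (submetric euclidean_metric {0..1})) (mtopology_of inner_space) \<gamma>"
    by (rule Lipschitz_continuous_imp_continuous_map)
  then have "pathin (mtopology_of inner_space) \<gamma>"
    by (simp add: pathin_def mtopology_of_submetric)
  moreover have "\<gamma> 0 = (\<lambda>w\<in>ball 0 1. b * hp_prod A (cayley \<xi> w))"
    by (simp add: \<gamma>_def ph_def xy move_0 move_1)
  moreover have "\<gamma> 1 = (\<lambda>w\<in>ball 0 1. c * hp_prod (\<lambda>n. A (Suc n)) (cayley \<xi> w))"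
    by (simp add: \<gamma>_def ph_def xy move_0 move_1)
  ultimately show ?thesis
    unfolding path_component_of_def by blast
qed


section \<open>Blaschke products of the disk as half-plane products\<close>

text \<open>Corresponding factors agree up to unimodular constants independent of w, and both
  families of partial products converge. It remains to collect the constants.\<close>

lemma (in nontangential) blaschke_eq_hp_prod:
  assumes B: "blaschke_with_zeros z B" and \<xi>: "cmod \<xi> = 1" and A: "A = (\<lambda>n. cayley \<xi> (z n))"
  obtains c where "cmod c = 1" "B = (\<lambda>w\<in>ball 0 1. c * hp_prod A (cayley \<xi> w))"
proof -
  from B obtain b where z: "\<And>n. cmod (z n) < 1" and sm: "summable (\<lambda>n. 1 - cmod (z n))"
    and b: "cmod b = 1"
    and B_eq: "B = (\<lambda>w\<in>ball 0 1. b * w ^ card {n. z n = 0} *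
               (\<Prod>n. if z n = 0 then 1
                     else complex_of_real (cmod (z n)) / z n * ((z n - w) / (1 - cnj (z n) * w))))"
    unfolding blaschke_with_zeros_def by (auto simp: image_subset_iff)
  define g where "g n w = (if z n = 0 then 1
      else complex_of_real (cmod (z n)) / z n * ((z n - w) / (1 - cnj (z n) * w)))" for n w
  have "\<exists>\<mu>. cmod \<mu> = 1 \<and> (\<forall>w. cmod w < 1 \<longrightarrow>
      (if z n = 0 then w else 1) * g n w = \<mu> * hp_factor (A n) (cayley \<xi> w))" for n
  proof -
    obtain \<mu> where \<mu>: "cmod \<mu> = 1"
      "\<And>w. cmod w < 1 \<Longrightarrow> (z n - w) / (1 - cnj (z n) * w) =
        \<mu> * ((A n - cayley \<xi> w) / (cnj (A n) + cayley \<xi> w))"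
      using disk_factor_eq_hp_quotient[OF \<xi> z[of n]] unfolding A by metis
    \<comment> \<open>For a zero at the origin the Blaschke factor is w, whereas the quotient equals
      -w; hence the value -1.\<close>
    define \<nu> where "\<nu> = (if z n = 0 then - 1 else complex_of_real (cmod (z n)) / z n)"
    have nz: "A n \<noteq> 0" using Re_pos[of n] by auto
    have "(if z n = 0 then w else 1) * g n w = \<nu> * ((z n - w) / (1 - cnj (z n) * w))" for w
      by (simp add: \<nu>_def g_def)
    also have "\<nu> * ((z n - w) / (1 - cnj (z n) * w)) =
        (\<nu> * \<mu> * (A n / cnj (A n))) * hp_factor (A n) (cayley \<xi> w)" if "cmod w < 1" for w
      using nz by (simp add: \<mu>(2)[OF that] hp_factor_def)
    moreover have "cmod (\<nu> * \<mu> * (A n / cnj (A n))) = 1"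
      using nz \<mu>(1) by (simp add: norm_mult norm_divide \<nu>_def)
    ultimately show ?thesis by metis
  qed
  then obtain \<mu> where \<mu>: "\<And>n. cmod (\<mu> n) = 1"
    "\<And>n w. cmod w < 1 \<Longrightarrow>
      (if z n = 0 then w else 1) * g n w = \<mu> n * hp_factor (A n) (cayley \<xi> w)"
    by metis
  \<comment> \<open>The two normalisations differ by unimodular constants; a convergent subsequence of their
    partial products suffices, which avoids showing that the limits do not vanish.\<close>
  have "compact (sphere 0 1 :: complex set)" by (rule compact_sphere)
  moreover have "(\<Prod>n<N. \<mu> n) \<in> sphere 0 1" for N
    using \<mu>(1) by (simp add: prod_norm[symmetric])
  ultimately obtain l s where l: "l \<in> sphere 0 1" and s: "strict_mono (s :: nat \<Rightarrow> nat)"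
    and lim: "((\<lambda>N. \<Prod>n<N. \<mu> n) \<circ> s) \<longlonglongrightarrow> l"
    using compact_imp_seq_compact seq_compactE by metis
  have lim_z: "(\<lambda>n. cmod (z n)) \<longlonglongrightarrow> 1"
    using tendsto_diff[OF tendsto_const[of 1] summable_LIMSEQ_zero[OF sm]] by simp
  then have "\<forall>\<^sub>F n in sequentially. cmod (z n) > 0"
    by (rule order_tendstoD) simp
  then obtain N0 where N0: "\<And>n. n \<ge> N0 \<Longrightarrow> z n \<noteq> 0"
    by (auto simp: eventually_sequentially)
  have conv: "(\<lambda>N. \<Prod>n<N. g n w) \<longlonglongrightarrow> (\<Prod>n. g n w)" if w: "cmod w < 1" for w
  proof -
    \<comment> \<open>The classical estimate: the numerator of the difference contains the factor |z
      n| - 1, so the Blaschke condition gives absolute convergence.\<close>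
    have "cmod (g n w - 1) \<le> 2 / (1 - cmod w) * (1 - cmod (z n))" for n
    proof (cases "z n = 0")
      case False
      define r where "r = cmod (z n)"
      have r: "r > 0" "r < 1" using False z[of n] by (auto simp: r_def)
      have "cmod (cnj (z n) * w) \<le> cmod w"
        using r by (simp add: norm_mult r_def[symmetric] mult_left_le_one_le)
      then have den: "1 - cmod w \<le> cmod (1 - cnj (z n) * w)"
        using norm_triangle_ineq2[of 1 "cnj (z n) * w"] by simp
      then have nz: "1 - cnj (z n) * w \<noteq> 0" using w by auto
      have rr: "z n * cnj (z n) = of_real r * of_real r"
        unfolding r_def complex_norm_square[symmetric] by (simp add: power2_eq_square)
      have "g n w - 1 = (of_real r * (z n - w) - z n * (1 - cnj (z n) * w)) / (z n * (1 - cnj (z n) * w))"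
      proof -
        have "g n w = of_real r * (z n - w) / (z n * (1 - cnj (z n) * w))"
          using False by (simp only: g_def r_def if_False times_divide_times_eq)
        moreover have "z n * (1 - cnj (z n) * w) \<noteq> 0" using False nz by (simp only: mult_eq_0_iff) simp
        ultimately show ?thesis by (simp only: diff_divide_distrib divide_self not_False_eq_True)
      qed
      also have "of_real r * (z n - w) - z n * (1 - cnj (z n) * w) = of_real (r - 1) * (z n + of_real r * w)"
        using rr by (simp add: algebra_simps)
      finally have "cmod (g n w - 1) = (1 - r) * cmod (z n + of_real r * w) / (r * cmod (1 - cnj (z n) * w))"
        using r by (simp add: norm_mult norm_divide r_def[symmetric] del: of_real_diff)
      also have "\<dots> \<le> (1 - r) * (2 * r) / (r * (1 - cmod w))"
      proof -
        have "cmod (z n + of_real r * w) \<le> r + r * cmod w"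
          by (rule order_trans[OF norm_triangle_ineq]) (use r in \<open>simp add: norm_mult r_def[symmetric]\<close>)
        also have "\<dots> \<le> 2 * r"
          using r w by (simp add: mult_left_le)
        finally show ?thesis
          using r w den by (intro frac_le mult_left_mono mult_nonneg_nonneg mult_pos_pos) auto
      qed
      finally show ?thesis using r by (simp add: r_def mult.commute)
    qed (use w in \<open>simp add: g_def\<close>)
    then have "summable (\<lambda>n. cmod (g n w - 1))"
      by (intro summable_comparison_test'[OF summable_mult[OF sm, of "2 / (1 - cmod w)"]]) auto
    then have "convergent_prod (\<lambda>n. g n w)"
      by (intro abs_convergent_prod_imp_convergent_prod summable_imp_abs_convergent_prod)
    then have "(\<lambda>N. \<Prod>n\<le>N. g n w) \<longlonglongrightarrow> (\<Prod>n. g n w)"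
      by (rule convergent_prod_LIMSEQ)
    then show ?thesis
      \<comment> \<open>The library limit runs over n \<le> N; an index shift turns it into one over
        n < N.\<close>
      by (subst (asm) lessThan_Suc_atMost[symmetric]) (rule LIMSEQ_imp_Suc)
  qed
  have "w ^ card {n. z n = 0} * (\<Prod>n. g n w) = l * hp_prod A (cayley \<xi> w)" if w: "cmod w < 1" for w
  proof (rule LIMSEQ_unique)
    let ?P = "\<lambda>N. \<Prod>n<N. (if z n = 0 then w else 1) * g n w"
    have "?P N = w ^ card {n. z n = 0} * (\<Prod>n<N. g n w)" if "N \<ge> N0" for N
    proof -
      \<comment> \<open>From \<open>N0\<close> on, the partial product already contains all zeros at
        the origin, so the factors w multiply to the full power.\<close>
      have "n < N" if "z n = 0" for n
        using N0[of n] that \<open>N \<ge> N0\<close> by (cases "n < N") auto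
      then have "{n. z n = 0} = {..<N} \<inter> {n. z n = 0}" by blast
      then show ?thesis
        by (simp add: prod.distrib prod.If_cases)
    qed
    then have "\<forall>\<^sub>F N in sequentially. w ^ card {n. z n = 0} * (\<Prod>n<N. g n w) = ?P N"
      by (auto intro!: eventually_sequentiallyI[of N0])
    then have "?P \<longlonglongrightarrow> w ^ card {n. z n = 0} * (\<Prod>n. g n w)"
      by (rule Lim_transform_eventually[rotated]) (intro tendsto_intros conv w)
    then show "(?P \<circ> s) \<longlonglongrightarrow> w ^ card {n. z n = 0} * (\<Prod>n. g n w)"
      using s by (rule LIMSEQ_subseq_LIMSEQ)
    have "((\<lambda>N. \<Prod>n<N. hp_factor (A n) (cayley \<xi> w)) \<circ> s) \<longlonglongrightarrow> hp_prod A (cayley \<xi> w)"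
      using hp_prod_LIMSEQ[of "cayley \<xi> w"] Re_cayley_pos[OF \<xi> w] s
      by (intro LIMSEQ_subseq_LIMSEQ) auto
    from tendsto_mult[OF lim this]
    show "(?P \<circ> s) \<longlonglongrightarrow> l * hp_prod A (cayley \<xi> w)"
      by (simp add: o_def \<mu>(2)[OF w] prod.distrib)
  qed
  then have "B = (\<lambda>w\<in>ball 0 1. (b * l) * hp_prod A (cayley \<xi> w))"
    unfolding B_eq g_def[symmetric] by (intro restrict_ext) (simp add: mult.assoc)
  moreover have "cmod (b * l) = 1"
    using b l by (simp add: norm_mult)
  ultimately show ?thesis using that by blast
qed

section \<open>Prepending a zero\<close>

lemma hp_prod_case_nat:
  assumes "nontangential (case_nat a A) R \<kappa>" "nontangential A R' \<kappa>'" "Re v \<ge> 0"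
  shows "hp_prod (case_nat a A) v = hp_factor a v * hp_prod A v"
proof (rule LIMSEQ_unique)
  show "(\<lambda>N. \<Prod>n<Suc N. hp_factor (case_nat a A n) v) \<longlonglongrightarrow> hp_prod (case_nat a A) v"
    using nontangential.hp_prod_LIMSEQ[OF assms(1,3)] by (rule LIMSEQ_Suc)
  show "(\<lambda>N. \<Prod>n<Suc N. hp_factor (case_nat a A n) v) \<longlonglongrightarrow> hp_factor a v * hp_prod A v"
    unfolding prod.lessThan_Suc_shift using nontangential.hp_prod_LIMSEQ[OF assms(2,3)]
    by (auto intro: tendsto_intros)
qed

text \<open>Prepending adds a single new instance to each condition, and one instance can always be
  absorbed by adjusting the constants.\<close>

lemma zero_shift_case_nat:
  assumes "zero_shift A R \<kappa> K C" and a: "Re a > 0" and r: "r > 0" "r \<le> R 0" "cmod a \<le> 2 * r"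
  obtains \<kappa>' K' C' where "zero_shift (case_nat a A) (case_nat r R) \<kappa>' K' C'"
proof
  interpret zero_shift A R \<kappa> K C by fact
  define \<kappa>' where "\<kappa>' = min \<kappa> (Re a / r)"
  define K' where "K' = max K (R 0 / r)"
  define C' where "C' = Max {C, cmod (A 0 - a), \<bar>Im (A 0 * cnj a)\<bar> / r}"
  have \<kappa>': "\<kappa>' \<le> \<kappa>" "\<kappa>' \<le> Re a / r" by (auto simp: \<kappa>'_def)
  have K': "K \<le> K'" "R 0 / r \<le> K'" by (auto simp: K'_def)
  have C': "C \<le> C'" "cmod (A 0 - a) \<le> C'" "\<bar>Im (A 0 * cnj a)\<bar> / r \<le> C'"
    by (auto simp: C'_def)
  show "zero_shift (case_nat a A) (case_nat r R) \<kappa>' K' C'"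
  proof
    show "\<kappa>' > 0" using \<kappa>_pos a r by (simp add: \<kappa>'_def)
    show "summable (\<lambda>n. 1 / (case_nat r R n))"
      by (subst summable_Suc_iff[symmetric]) (simp add: summable_R)
    fix n
    show "case_nat r R n > 0" using R_pos r by (simp split: nat.split)
    show "\<kappa>' * (case_nat r R n) \<le> Re (case_nat a A n)"
    proof (cases n)
      case 0
      then show ?thesis using \<kappa>' r by (simp add: pos_le_divide_eq)
    next
      case (Suc m)
      have "\<kappa>' * R m \<le> \<kappa> * R m" using \<kappa>' R_pos[of m] by simp
      then show ?thesis using Suc Re_ge[of m] by simp
    qed
    show "case_nat r R n \<le> case_nat r R (Suc n)"
      using R_mono r by (simp split: nat.split)
    show "case_nat r R (Suc n) \<le> K' * case_nat r R n"
    proof (cases n)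
      case 0
      then show ?thesis using K' r by (simp add: pos_divide_le_eq)
    next
      case (Suc m)
      have "K * R m \<le> K' * R m" using K' R_pos[of m] by simp
      then show ?thesis using Suc R_growth[of m] by simp
    qed
    show "cmod (case_nat a A n) \<le> 2 * case_nat r R n"
      using norm_le r by (simp split: nat.split)
    show "cmod (case_nat a A (Suc n) - case_nat a A n) \<le> case_nat r R (Suc n) - case_nat r R n + C'"
    proof (cases n)
      case 0
      then show ?thesis using C' r by simp
    next
      case (Suc m)
      then show ?thesis using step[of m] C' by simp
    qed
    show "\<bar>Im (case_nat a A (Suc n) * cnj (case_nat a A n))\<bar> \<le> C' * case_nat r R n"
    proof (cases n)
      case 0
      then show ?thesis using C' r by (simp add: pos_divide_le_eq)
    next
      case (Suc m)
      have "C * R m \<le> C' * R m" using C' R_pos[of m] by simp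
      then show ?thesis using Suc area[of m] by simp
    qed
  qed
qed

section \<open>Zeros in a strip cone\<close>

text \<open>Rotation by \<theta> makes the strip vertical, so |u| and |Im (cis \<theta> * u)| differ
  by a bounded amount. As sin \<theta> > 0, the condition Re u \<ge> 0 leaves only the upper end of
  the strip, where Re u grows at least like sin \<theta> * |u| up to a constant.\<close>

lemma strip_bounds:
  assumes \<theta>: "\<theta> \<in> {0<..<pi}" and S: "\<bar>Re (cis \<theta> * u)\<bar> \<le> S" and u: "Re u \<ge> 0"
  shows "cmod u - (S + 2 * S / sin \<theta>) \<le> Im (cis \<theta> * u)"
    and "sin \<theta> * (cmod u - (S + 2 * S / sin \<theta>)) - S \<le> Re u"
proof -
  define s t where "s = Re (cis \<theta> * u)" and "t = Im (cis \<theta> * u)"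
  have sin: "sin \<theta> > 0" using \<theta> by (simp add: sin_gt_zero)
  have "u = cis (- \<theta>) * (cis \<theta> * u)"
    by (simp add: mult.assoc[symmetric] cis_mult)
  then have "Re u = Re (cis (- \<theta>) * (cis \<theta> * u))" by (rule arg_cong)
  also have "\<dots> = cos \<theta> * s + sin \<theta> * t"
    by (simp only: s_def t_def times_complex.sel cis.sel cos_minus sin_minus mult_minus_left diff_minus_eq_add)
  finally have Re_u: "Re u = cos \<theta> * s + sin \<theta> * t" .
  have cs: "\<bar>cos \<theta> * s\<bar> \<le> S"
  proof -
    have "\<bar>cos \<theta>\<bar> * \<bar>s\<bar> \<le> 1 * S"
      using S by (intro mult_mono) (auto simp: s_def)
    then show ?thesis by (simp add: abs_mult)
  qed
  have "- S \<le> sin \<theta> * t" using Re_u u cs by linarith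
  \<comment> \<open>This lower bound allows |t| to be replaced by t at the cost of 2 * S / sin
    \<theta>.\<close>
  then have t: "- (S / sin \<theta>) \<le> t" using sin by (simp add: field_simps)
  have "cmod u = cmod (cis \<theta> * u)" by (simp add: norm_mult)
  also have "\<dots> \<le> \<bar>s\<bar> + \<bar>t\<bar>" unfolding s_def t_def by (rule cmod_le)
  finally have "cmod u \<le> S + \<bar>t\<bar>" using S by (simp add: s_def)
  moreover have "S \<ge> 0" using S by linarith
  then have "S / sin \<theta> \<ge> 0" using sin by simp
  ultimately show 1: "cmod u - (S + 2 * S / sin \<theta>) \<le> Im (cis \<theta> * u)"
    unfolding t_def[symmetric] times_divide_eq_right[symmetric] using t by linarith
  have "sin \<theta> * (cmod u - (S + 2 * S / sin \<theta>)) \<le> sin \<theta> * t"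
    using 1 sin by (simp add: t_def)
  then show "sin \<theta> * (cmod u - (S + 2 * S / sin \<theta>)) - S \<le> Re u"
    using Re_u cs by linarith
qed

text \<open>This extends the nontangential estimate, which the strip gives only far out, to the
  finitely many early zeros.\<close>

lemma positive_lower_bound:
  fixes f :: "nat \<Rightarrow> real"
  assumes "\<And>n. f n > 0" and "\<forall>\<^sub>F n in sequentially. c \<le> f n" and "c > 0"
  obtains k where "k > 0" "\<And>n. k \<le> f n"
proof -
  obtain N where N: "\<And>n. n \<ge> N \<Longrightarrow> c \<le> f n"
    using assms(2) by (auto simp: eventually_sequentially)
  define k where "k = Min (insert c (f ` {..<N}))"
  have "k > 0" unfolding k_def using assms by (subst Min_gr_iff) auto
  moreover have "k \<le> f n" for n
  proof (cases "n < N")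
    case True
    then show ?thesis unfolding k_def by (intro Min_le) auto
  next
    case False
    then have "c \<le> f n" using N by simp
    moreover have "k \<le> c" unfolding k_def by (intro Min_le) auto
    ultimately show ?thesis by simp
  qed
  ultimately show ?thesis using that by blast
qed

text \<open>The scale is |u n| rather than the modulus of the zero u n - 1/2, because it is |u n|,
  the inverse distance of the disk zero to \<xi>, that is monotone by hypothesis. The last
  assumption is the Blaschke condition in this coordinate.\<close>

lemma zero_shift_strip:
  fixes u :: "nat \<Rightarrow> complex"
  assumes \<theta>: "\<theta> \<in> {0<..<pi}" and S: "\<And>n. \<bar>Re (cis \<theta> * u n)\<bar> \<le> S"
    and u: "\<And>n. Re (u n) > 1 / 2"
    and mono: "\<And>n. cmod (u n) \<le> cmod (u (Suc n))"
    and growth: "\<And>n. cmod (u (Suc n)) \<le> K * cmod (u n)"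
    and lim: "filterlim (\<lambda>n. cmod (u n)) at_top sequentially"
    and sm: "summable (\<lambda>n. (Re (u n) - 1 / 2) / (cmod (u n))\<^sup>2)"
  obtains \<kappa> C where "zero_shift (\<lambda>n. u n - 1 / 2) (\<lambda>n. cmod (u n)) \<kappa> K C"
proof -
  define r where "r n = cmod (u n)" for n
  define D where "D = S + 2 * S / sin \<theta>"
  have sin: "sin \<theta> > 0" using \<theta> by (simp add: sin_gt_zero)
  have S0: "S \<ge> 0" using S[of 0] by linarith
  then have D0: "D \<ge> 0" using sin by (simp add: D_def)
  have r: "r n > 1 / 2" for n
    using u[of n] complex_Re_le_cmod[of "u n"] by (simp add: r_def)
  have Re_u: "Re (u n) \<ge> 0" for n using u[of n] by simp
  note bounds = strip_bounds[OF \<theta> S Re_u, folded D_def, folded r_def]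
  obtain \<kappa> where \<kappa>: "\<kappa> > 0" "\<And>n. \<kappa> \<le> (Re (u n) - 1 / 2) / r n"
  proof (rule positive_lower_bound)
    show "(Re (u n) - 1 / 2) / r n > 0" for n
      using u[of n] r[of n] by (intro divide_pos_pos) auto
    \<comment> \<open>Beyond this threshold the constants lost in the lower bound for Re (u n)
      consume at most half of the main term sin \<theta> * r n.\<close>
    have "\<forall>\<^sub>F n in sequentially. 2 * (sin \<theta> * D + S + 1 / 2) / sin \<theta> \<le> r n"
      using lim by (simp add: r_def filterlim_at_top)
    then show "\<forall>\<^sub>F n in sequentially. sin \<theta> / 2 \<le> (Re (u n) - 1 / 2) / r n"
    proof eventually_elim
      case (elim n)
      then have "2 * (sin \<theta> * D + S + 1 / 2) \<le> sin \<theta> * r n"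
        using sin by (simp add: pos_divide_le_eq mult.commute)
      then have "sin \<theta> / 2 * r n \<le> Re (u n) - 1 / 2"
        using bounds(2)[of n] by (simp add: right_diff_distrib)
      then show ?case using r[of n] by (simp add: pos_le_divide_eq)
    qed
    show "sin \<theta> / 2 > 0" using sin by simp
  qed (use that in blast)
  \<comment> \<open>The part 2 * S + D pays for the step condition, the last summand for the area
    condition.\<close>
  define C where "C = 2 * S + D + (S + 1 / 2) * (2 * K + 2)"
  have K: "K \<ge> 1"
  proof (rule mult_right_le_imp_le)
    show "1 * r 0 \<le> K * r 0"
      using mono[of 0] growth[of 0] unfolding r_def by linarith
    show "r 0 > 0" using r[of 0] by simp
  qed
  have norm_a: "cmod (u n - 1 / 2) \<le> 2 * r n" for n
    using norm_triangle_ineq4[of "u n" "1 / 2"] r[of n] by (simp add: r_def norm_divide)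
  have "zero_shift (\<lambda>n. u n - 1 / 2) r \<kappa> K C"
  proof
    show "\<kappa> > 0" by (rule \<kappa>)
    show "summable (\<lambda>n. 1 / r n)"
    proof (rule summable_comparison_test')
      show "summable (\<lambda>n. 1 / \<kappa> * ((Re (u n) - 1 / 2) / (cmod (u n))\<^sup>2))"
        by (intro summable_mult sm)
      fix n
      \<comment> \<open>Nontangentiality turns the Blaschke condition into summability of the
        inverse scale.\<close>
      have "1 / r n * \<kappa> \<le> 1 / r n * ((Re (u n) - 1 / 2) / r n)"
        using r[of n] \<kappa>(2)[of n] by (intro mult_left_mono) auto
      also have "\<dots> = (Re (u n) - 1 / 2) / (r n)\<^sup>2"
        by (simp add: power2_eq_square)
      finally have "1 / r n \<le> (Re (u n) - 1 / 2) / (r n)\<^sup>2 / \<kappa>"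
        by (simp only: pos_le_divide_eq[OF \<kappa>(1)])
      then have "1 / r n \<le> 1 / \<kappa> * ((Re (u n) - 1 / 2) / (r n)\<^sup>2)"
        by (simp add: mult.commute)
      then show "norm (1 / r n) \<le> 1 / \<kappa> * ((Re (u n) - 1 / 2) / (cmod (u n))\<^sup>2)"
        using r[of n] by (simp add: r_def[symmetric])
    qed
    fix n
    show "r n > 0" using r[of n] by simp
    show "\<kappa> * r n \<le> Re (u n - 1 / 2)"
      using \<kappa>(2)[of n] r[of n] by (simp add: pos_le_divide_eq)
    show "r n \<le> r (Suc n)" "r (Suc n) \<le> K * r n"
      using mono growth by (auto simp: r_def)
    show "cmod (u n - 1 / 2) \<le> 2 * r n" by (rule norm_a)
    \<comment> \<open>Coordinates across and along the strip: \<open>s\<close> is bounded by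
      \<open>S\<close>, and \<open>t\<close> differs from \<open>r\<close> by at most
      \<open>D\<close>.\<close>
    define s t where "s n = Re (cis \<theta> * u n)" and "t n = Im (cis \<theta> * u n)" for n
    have t: "r n - D \<le> t n" "t n \<le> r n" for n
      using bounds(1)[of n] abs_Im_le_cmod[of "cis \<theta> * u n"]
      by (auto simp: t_def r_def norm_mult)
    have extra: "0 \<le> (S + 1 / 2) * (2 * K + 2)" using S0 K by simp
    have "cmod (u (Suc n) - u n) = cmod (cis \<theta> * u (Suc n) - cis \<theta> * u n)"
      by (metis mult_1 norm_cis norm_mult right_diff_distrib)
    also have "\<dots> \<le> \<bar>s (Suc n) - s n\<bar> + \<bar>t (Suc n) - t n\<bar>"
      unfolding s_def t_def minus_complex.sel[symmetric] by (rule cmod_le)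
    also have "\<dots> \<le> r (Suc n) - r n + C"
      using S[of n] S[of "Suc n"] t[of n] t[of "Suc n"] mono[of n] D0 extra
      unfolding C_def s_def r_def by linarith
    finally show "cmod ((u (Suc n) - 1 / 2) - (u n - 1 / 2)) \<le> r (Suc n) - r n + C" by simp
    \<comment> \<open>Rotation preserves Im (x * cnj y), and the rotated zeros have bounded real
      parts, so this quantity grows at most linearly in the scale.\<close>
    define y where "y n = cis \<theta> * (u n - 1 / 2)" for n
    have Re_y: "\<bar>Re (y n)\<bar> \<le> S + 1 / 2" for n
    proof -
      have "Re (y n) = s n - cos \<theta> / 2" by (simp add: y_def s_def algebra_simps)
      then show ?thesis
        using S[of n] abs_cos_le_one[of \<theta>] unfolding s_def by linarith
    qed
    have Im_y: "\<bar>Im (y n)\<bar> \<le> 2 * r n" for n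
      using abs_Im_le_cmod[of "y n"] norm_a[of n] by (simp add: y_def norm_mult)
    have "(u (Suc n) - 1 / 2) * cnj (u n - 1 / 2) = y (Suc n) * cnj (y n)"
    proof -
      have "cis \<theta> * cnj (cis \<theta>) = 1" by (simp add: cis_cnj cis_mult)
      then show ?thesis unfolding y_def complex_cnj_mult by (metis mult.assoc mult.commute mult_1)
    qed
    then have "\<bar>Im ((u (Suc n) - 1 / 2) * cnj (u n - 1 / 2))\<bar> =
        \<bar>Im (y (Suc n)) * Re (y n) - Re (y (Suc n)) * Im (y n)\<bar>"
      by (simp only: times_complex.sel complex_cnj) simp
    also have "\<dots> \<le> \<bar>Im (y (Suc n))\<bar> * \<bar>Re (y n)\<bar> + \<bar>Re (y (Suc n))\<bar> * \<bar>Im (y n)\<bar>"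
      by (metis abs_mult abs_triangle_ineq4)
    also have "\<dots> \<le> 2 * r (Suc n) * (S + 1 / 2) + (S + 1 / 2) * (2 * r n)"
      using r[of "Suc n"] S0 by (intro add_mono mult_mono Re_y Im_y) auto
    also have "\<dots> \<le> 2 * (K * r n) * (S + 1 / 2) + (S + 1 / 2) * (2 * r n)"
      using growth[of n] S0 by (intro add_right_mono mult_right_mono mult_left_mono) (auto simp: r_def)
    also have "\<dots> \<le> C * r n"
      using S0 D0 r[of n] by (simp add: C_def algebra_simps)
    finally show "\<bar>Im ((u (Suc n) - 1 / 2) * cnj (u n - 1 / 2))\<bar> \<le> C * r n" .
  qed
  then show ?thesis using that unfolding r_def by blast
qed

section \<open>Application to the zeros of a product in \<open>H_SC\<close>\<close>

theorem mainTheorem1: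
  fixes B :: "complex \<Rightarrow> complex"
  assumes "B \<in> H_SC"
  shows "path_component_of (mtopology_of inner_space) B (\<lambda>z\<in>ball 0 1. z * B z)"
proof -
  obtain z \<xi> \<theta> T1 T2 \<delta> where B: "blaschke_with_zeros z B"
    and \<xi>: "cmod \<xi> = 1" and \<theta>: "\<theta> \<in> {0<..<pi}"
    and strip: "range z \<subseteq> strip_cone \<xi> \<theta> T1 T2"
    and dec: "decseq (\<lambda>n. cmod (\<xi> - z n))" and lim: "(\<lambda>n. cmod (\<xi> - z n)) \<longlonglongrightarrow> 0"
    and \<delta>: "0 < \<delta>" "\<delta> < 1" "\<And>n. pseudo_hyp_dist (z n) (z (Suc n)) \<le> \<delta>"
    using assms unfolding H_SC_def by auto
  define u a where "u n = \<xi> / (\<xi> - z n)" and "a n = cayley \<xi> (z n)" for n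
  have a_eq: "a n = u n - 1 / 2" for n by (simp add: a_def u_def cayley_def)
  have z: "cmod (z n) < 1" for n
    using B by (auto simp: blaschke_with_zeros_def image_subset_iff)
  have nz: "\<xi> - z n \<noteq> 0" for n using \<xi> z[of n] by auto
  have norm_u: "cmod (u n) = 1 / cmod (\<xi> - z n)" for n
    using \<xi> by (simp add: u_def norm_divide)
  have Re_a: "Re (a n) > 0" for n unfolding a_def by (rule Re_cayley_pos[OF \<xi> z])
  then have Re_u: "Re (u n) > 1 / 2" for n using a_eq[of n] Re_a[of n] by simp
  then have u_half: "cmod (u n) > 1 / 2" for n
    using complex_Re_le_cmod[of "u n"] by (meson less_le_trans)
  define p q where "p = real_of_ereal (1 / (2 * T1))" and "q = real_of_ereal (1 / (2 * T2))"
  \<comment> \<open>The growth constant arises from |a (Suc n)| \<le> (1 + \<delta>) / (1 -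
    \<delta>) * |a n|, together with |a n| \<le> 2 * |u n| and 1/2 \<le> |u n|.\<close>
  obtain \<kappa> C where "zero_shift (\<lambda>n. u n - 1 / 2) (\<lambda>n. cmod (u n)) \<kappa> (2 * ((1 + \<delta>) / (1 - \<delta>)) + 1) C"
  proof (rule zero_shift_strip)
    show "\<theta> \<in> {0<..<pi}" by (rule \<theta>)
    \<comment> \<open>The two parameters of the cone come in no particular order, hence the maximum
      of both absolute values.\<close>
    show "\<bar>Re (cis \<theta> * u n)\<bar> \<le> max \<bar>p\<bar> \<bar>q\<bar>" for n
    proof -
      have "Re (cis \<theta> * u n) \<in> closed_segment p q"
        using strip by (auto simp: strip_cone_def u_def p_def q_def image_subset_iff)
      then show ?thesis by (auto simp: closed_segment_eq_real_ivl split: if_splits)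
    qed
    show "Re (u n) > 1 / 2" for n by (rule Re_u)
    show "cmod (u n) \<le> cmod (u (Suc n))" for n
      unfolding norm_u using decseq_SucD[OF dec, of n] nz[of "Suc n"] nz[of n]
      by (intro divide_left_mono) auto
    show "cmod (u (Suc n)) \<le> (2 * ((1 + \<delta>) / (1 - \<delta>)) + 1) * cmod (u n)" for n
    proof -
      obtain \<mu> where \<mu>: "cmod \<mu> = 1"
        "(z n - z (Suc n)) / (1 - cnj (z n) * z (Suc n)) = \<mu> * ((a n - a (Suc n)) / (cnj (a n) + a (Suc n)))"
        using disk_factor_eq_hp_quotient[OF \<xi> z[of n]] z[of "Suc n"] unfolding a_def by metis
      have "cnj (a n) + a (Suc n) \<noteq> 0"
        using Re_a by (intro cnj_add_nonzero) (auto simp: less_imp_le)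
      \<comment> \<open>The pseudo-hyperbolic distance is the modulus of the half-plane
        quotient.\<close>
      then have "cmod (a n - a (Suc n)) \<le> \<delta> * cmod (cnj (a n) + a (Suc n))"
        using \<delta>(3)[of n] \<mu> by (simp add: pseudo_hyp_dist_def norm_mult norm_divide pos_divide_le_eq)
      also have "\<dots> \<le> \<delta> * (cmod (a n) + cmod (a (Suc n)))"
        using \<delta> norm_triangle_ineq[of "cnj (a n)" "a (Suc n)"] by simp
      finally have "cmod (a (Suc n)) - cmod (a n) \<le> \<delta> * (cmod (a n) + cmod (a (Suc n)))"
        using norm_triangle_ineq2[of "a (Suc n)" "a n"] by (simp add: norm_minus_commute)
      then have "cmod (a (Suc n)) * (1 - \<delta>) \<le> (1 + \<delta>) * cmod (a n)"
        by (simp add: algebra_simps)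
      then have 1: "cmod (a (Suc n)) \<le> (1 + \<delta>) / (1 - \<delta>) * cmod (a n)"
        using \<delta> by (simp add: pos_le_divide_eq)
      have "cmod (a n) \<le> 2 * cmod (u n)"
        using norm_triangle_ineq4[of "u n" "1 / 2"] u_half[of n] by (simp add: a_eq norm_divide)
      then have "(1 + \<delta>) / (1 - \<delta>) * cmod (a n) \<le> (1 + \<delta>) / (1 - \<delta>) * (2 * cmod (u n))"
        using \<delta> by (intro mult_left_mono) auto
      moreover have "cmod (u (Suc n)) \<le> cmod (a (Suc n)) + 1 / 2"
        using norm_triangle_ineq[of "a (Suc n)" "1 / 2"] by (simp add: a_eq norm_divide)
      ultimately have "cmod (u (Suc n)) \<le> (1 + \<delta>) / (1 - \<delta>) * (2 * cmod (u n)) + cmod (u n)"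
        using 1 u_half[of n] by linarith
      then show ?thesis by (simp only: distrib_left mult_ac mult_1_right)
    qed
    have "filterlim (\<lambda>n. cmod (\<xi> - z n)) (at_right 0) sequentially"
      using lim nz by (intro tendsto_imp_filterlim_at_right) auto
    then show "filterlim (\<lambda>n. cmod (u n)) at_top sequentially"
      unfolding norm_u divide_inverse mult_1
      by (rule filterlim_compose[OF filterlim_inverse_at_top_right])
    \<comment> \<open>The distance to \<xi> cancels, leaving exactly (1 - |z n|^2) / 2.\<close>
    have "(Re (u n) - 1 / 2) / (cmod (u n))\<^sup>2 = (1 + cmod (z n)) * (1 - cmod (z n)) / 2" for n
    proof -
      have "Re (u n) - 1 / 2 = (1 - (cmod (z n))\<^sup>2) / (2 * (cmod (\<xi> - z n))\<^sup>2)"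
        using Re_cayley[OF \<xi>, of "z n"] nz[of n] by (simp add: cayley_def u_def)
      also have "\<dots> / (1 / cmod (\<xi> - z n))\<^sup>2 = (1 - (cmod (z n))\<^sup>2) / 2"
        using nz[of n] by (simp add: power_divide)
      finally show ?thesis
        by (simp add: norm_u power2_eq_square algebra_simps)
    qed
    moreover have "norm ((1 + cmod (z n)) * (1 - cmod (z n)) / 2) \<le> 1 - cmod (z n)" for n
      using z[of n] mult_right_mono[of "1 + cmod (z n)" 2 "1 - cmod (z n)"] by (simp add: abs_mult)
    moreover have "summable (\<lambda>n. 1 - cmod (z n))"
      using B by (simp add: blaschke_with_zeros_def)
    ultimately show "summable (\<lambda>n. (Re (u n) - 1 / 2) / (cmod (u n))\<^sup>2)"
      by (simp only:) (rule summable_comparison_test')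
  qed
  then have shift: "zero_shift a (\<lambda>n. cmod (u n)) \<kappa> (2 * ((1 + \<delta>) / (1 - \<delta>)) + 1) C"
    by (simp only: a_eq[abs_def])
  then interpret zero_shift a "\<lambda>n. cmod (u n)" \<kappa> "2 * ((1 + \<delta>) / (1 - \<delta>)) + 1" C .
  obtain c where c: "cmod c = 1" and B_eq: "B = (\<lambda>w\<in>ball 0 1. c * hp_prod a (cayley \<xi> w))"
    using blaschke_eq_hp_prod[OF B \<xi>] unfolding a_def by metis
  \<comment> \<open>The origin corresponds to the point \<open>1 / 2\<close> of the half-plane.\<close>
  obtain \<kappa>' K' C' where
    shift': "zero_shift (case_nat (1 / 2) a) (case_nat (1 / 2) (\<lambda>n. cmod (u n))) \<kappa>' K' C'"
    using zero_shift_case_nat[OF shift, of "1 / 2" "1 / 2"] u_half[of 0]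
    by (auto simp: norm_divide)
  have "(\<lambda>w\<in>ball 0 1. - \<xi> * c * hp_prod (case_nat (1 / 2) a) (cayley \<xi> w)) = (\<lambda>w\<in>ball 0 1. w * B w)"
  proof (rule restrict_ext)
    fix w :: complex assume "w \<in> ball 0 1"
    then have w: "cmod w < 1" by simp
    have "hp_prod (case_nat (1 / 2) a) (cayley \<xi> w) = hp_factor (1 / 2) (cayley \<xi> w) * hp_prod a (cayley \<xi> w)"
      using Re_cayley_pos[OF \<xi> w] zero_shift.axioms(1)[OF shift'] nontangential_axioms
      by (intro hp_prod_case_nat) auto
    then have "- \<xi> * c * hp_prod (case_nat (1 / 2) a) (cayley \<xi> w) =
        - \<xi> * hp_factor (1 / 2) (cayley \<xi> w) * (c * hp_prod a (cayley \<xi> w))"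
      by (simp only: mult_ac)
    also have "\<dots> = w * B w"
      using w by (simp only: hp_factor_origin[OF \<xi> w, symmetric]) (simp add: B_eq)
    finally show "- \<xi> * c * hp_prod (case_nat (1 / 2) a) (cayley \<xi> w) = w * B w" .
  qed
  \<comment> \<open>Dropping the first entry of \<open>case_nat (1 / 2) a\<close> gives back
    \<open>a\<close>, so this path leads from the product with the extra factor to
    \<open>B\<close>.\<close>
  with zero_shift.path_component_of_shift[OF shift' \<xi>, of "- \<xi> * c" c]
  have "path_component_of (mtopology_of inner_space) (\<lambda>w\<in>ball 0 1. w * B w) B"
    using \<xi> c by (simp add: norm_mult B_eq)
  then show ?thesis by (rule path_component_of_sym)
qed

end
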